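(* Let $X$ and $Y$ be reflexive and strictly convex real Banach spaces, let $A\colon X\to Y$ be a bounded linear operator with metric generalized inverse $A^\dagger\colon\mathcal D(A^\dagger)\subset Y\to X$, and let $x_\alpha\colon Y\to X$, $\alpha>0$, be a parametric regularization. Let $y\in Y$. Either $y\in\mathcal D(A^\dagger)$, and there is a unique minimum norm solution $x_\ast(y)=A^\dagger y$, and then $x_\alpha(y)\to x_\ast(y)$ in $X$ as $\alpha\to0$; or $y\notin\mathcal D(A^\dagger)$, and then $\|x_\alpha(y)\|_X\to\infty$ as $\alpha\to0$.
   Context: $\mathcal N(A)\subset X$ is the null-space and $\mathcal R(A)\subset Y$ the (not necessarily closed) range of $A$. For a closed linear subspace $U$ of a reflexive strictly convex Banach space $Z$, the metric projection $\pi_U\colon Z\to U$ maps $z$ to the unique element of $U$ with $\|z-\pi_U(z)\|=\inf_{u\in U}\|z-u\|$. The duality map is $J_X(x)=\{x'\in X':\langle x',x\rangle=\|x\|_X^2=\|x'\|_{X'}^2\}$, similarly $J_Y$. Put $C_X(A)=\{x\in X:J_X(x)\cap\mathcal N(A)^\perp\neq\emptyset\}$ and $C_Y(A)=\{y\in Y:J_Y(y)\cap\mathcal R(A)^\perp\neq\emptyset\}$ (annihilators in the dual spaces); $A$ maps $C_X(A)$ injectively onto $\mathcal R(A)$. The metric generalized inverse $A^\dagger$ has domain $\mathcal D(A^\dagger)=\mathcal R(A)+C_Y(A)=\{y\in Y:\pi_{\overline{\mathcal R(A)}}y\in\mathcal R(A)\}$ and is given by $A^\dagger y=(A|_{C_X(A)})^{-1}(\pi_{\overline{\mathcal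 R(A)}}y)$. For $y\in\mathcal D(A^\dagger)$, $x_\ast(y):=A^\dagger y$ is the minimum norm solution, i.e. the unique element of minimal norm among all minimizers of $x\mapsto\|Ax-y\|_Y$ over $X$. A family of mappings $x_\alpha\colon Y\to X$, $\alpha>0$, is called a (parametric) regularization if, as $\alpha\to0$, $x_\alpha(y)\to A^\dagger y$ for all $y\in\mathcal D(A^\dagger)$ and $Ax_\alpha(y)\to\pi_{\overline{\mathcal R(A)}}y$ for all $y\in Y$ (norm convergence). *)

theory Defs
  imports "HOL-Analysis.Analysis"
begin

definition reflexive_space :: "'a::real_normed_vector itself \<Rightarrow> bool" where
  "reflexive_space _ \<longleftrightarrow>
    (\<forall>\<phi> :: ('a \<Rightarrow>\<^sub>L real) \<Rightarrow>\<^sub>L real. \<exists>x :: 'a. \<forall>f. blinfun_apply \<phi> f = blinfun_apply f x)"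

definition strictly_convex_space :: "'a::real_normed_vector itself \<Rightarrow> bool" where
  "strictly_convex_space _ \<longleftrightarrow>
    (\<forall>u v :: 'a. norm u = 1 \<longrightarrow> norm v = 1 \<longrightarrow> u \<noteq> v \<longrightarrow> norm ((1/2) *\<^sub>R (u + v)) < 1)"

text \<open>The unique nearest point exists when \<open>U\<close> is a closed subspace of a reflexive strictly
  convex Banach space; otherwise the value may be unspecified.\<close>

definition metric_projection :: "'a::real_normed_vector set \<Rightarrow> 'a \<Rightarrow> 'a" where
  "metric_projection U z = (THE u. u \<in> U \<and> norm (z - u) = (INF v\<in>U. norm (z - v)))"

text \<open>The dual of \<open>'a\<close> is \<open>'a \<Rightarrow>\<^sub>L real\<close>, and \<open>norm f\<close> below is its operator norm.\<close>

definition duality_map :: "'a::real_normed_vector \<Rightarrow> ('a \<Rightarrow>\<^sub>L real) set" where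
  "duality_map x = {f. blinfun_apply f x = (norm x)\<^sup>2 \<and> (norm x)\<^sup>2 = (norm f)\<^sup>2}"

definition annihilator :: "'a::real_normed_vector set \<Rightarrow> ('a \<Rightarrow>\<^sub>L real) set" where
  "annihilator S = {f. \<forall>x\<in>S. blinfun_apply f x = 0}"

definition null_space :: "('a::real_normed_vector \<Rightarrow>\<^sub>L 'b::real_normed_vector) \<Rightarrow> 'a set" where
  "null_space A = {x. A x = 0}"

definition C_dom :: "('a::real_normed_vector \<Rightarrow>\<^sub>L 'b::real_normed_vector) \<Rightarrow> 'a set" where
  "C_dom A = {x. duality_map x \<inter> annihilator (null_space A) \<noteq> {}}"

definition C_cod :: "('a::real_normed_vector \<Rightarrow>\<^sub>L 'b::real_normed_vector) \<Rightarrow> 'b set" where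
  "C_cod A = {y. duality_map y \<inter> annihilator (range A) \<noteq> {}}"

definition mgi_domain :: "('a::real_normed_vector \<Rightarrow>\<^sub>L 'b::real_normed_vector) \<Rightarrow> 'b set" where
  "mgi_domain A = {r + c | r c. r \<in> range A \<and> c \<in> C_cod A}"

text \<open>The metric generalized inverse is a partial map; as a total function it is meaningful
  only on \<open>mgi_domain A\<close>.\<close>

definition mgi :: "('a::real_normed_vector \<Rightarrow>\<^sub>L 'b::real_normed_vector) \<Rightarrow> 'b \<Rightarrow> 'a" where
  "mgi A y = the_inv_into (C_dom A) A (metric_projection (closure (range A)) y)"

definition minimum_norm_solution ::
    "('a::real_normed_vector \<Rightarrow>\<^sub>L 'b::real_normed_vector) \<Rightarrow> 'b \<Rightarrow> 'a \<Rightarrow> bool" where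
  "minimum_norm_solution A y z \<longleftrightarrow>
    is_arg_min norm (is_arg_min (\<lambda>x. norm (A x - y)) (\<lambda>_. True)) z"

text \<open>The filter \<open>at_right 0\<close> makes the values of the family at parameters \<open>\<alpha> \<le> 0\<close>
  irrelevant.\<close>

definition parametric_regularization ::
    "('a::real_normed_vector \<Rightarrow>\<^sub>L 'b::real_normed_vector) \<Rightarrow> (real \<Rightarrow> 'b \<Rightarrow> 'a) \<Rightarrow> bool" where
  "parametric_regularization A x \<longleftrightarrow>
    (\<forall>y\<in>mgi_domain A. ((\<lambda>\<alpha>. x \<alpha> y) \<longlongrightarrow> mgi A y) (at_right 0)) \<and>
    (\<forall>y. ((\<lambda>\<alpha>. A (x \<alpha> y)) \<longlongrightarrow> metric_projection (closure (range A)) y) (at_right 0))"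

end

theory Submission
  imports Defs
begin

text \<open>The informative case is \<open>y \<notin> mgi_domain A\<close>.  Let \<open>r\<close> be the projection of \<open>y\<close> onto
  \<open>closure (range A)\<close>.  If \<open>norm (x \<alpha> y)\<close> did not tend to infinity, the approximations would
  stay in a fixed ball for parameters \<open>\<alpha>\<close> arbitrarily close to 0.  Since the domain space is reflexive,
  they then have a weak cluster point along these parameters.  Bounded operators are weakly
  continuous and \<open>A (x \<alpha> y)\<close> converges to \<open>r\<close>, so the cluster point is mapped to \<open>r\<close>
  (\<open>limit_in_range_of_bounded\<close>).  But \<open>r \<in> range A\<close> means exactly that \<open>y \<in> mgi_domain A\<close>.

  All the weak compactness comes from the Hahn--Banach theorem \<open>Hahn_Banach_sublinear\<close>, proved
  here by Zorn's lemma on sublinear functionals.  Applied in the dual space to an upper limit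
  along a bounded net, it produces an element of the bidual, hence, by reflexivity, a weak cluster
  point (\<open>reflexive_weak_cluster_point\<close>).  Applied to the distance from a subspace, it produces
  the separating functionals that localize such cluster points.  Together these give existence of
  nearest points in closed subspaces; strict convexity gives uniqueness.

  The remaining claims are translations into nearest points.  A point has a duality functional
  annihilating a subspace iff 0 is a nearest point to it in the subspace
  (\<open>duality_map_annihilator_iff\<close>).  For the range this identifies \<open>mgi_domain A\<close>.  For the null space it
  says that \<open>C_dom A\<close> consists of the norm-minimal elements of the fibres of \<open>A\<close>, so each fibre
  over the range contains exactly one of them, and the one over \<open>r\<close> is both \<open>mgi A y\<close> and
  the minimum norm solution.\<close>

section \<open>Linear functionals below a sublinear one\<close>

definition sublinear :: "('a::real_vector \<Rightarrow> real) \<Rightarrow> bool" where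
  "sublinear p \<longleftrightarrow> (\<forall>x y. p (x + y) \<le> p x + p y) \<and> (\<forall>t>0. \<forall>x. p (t *\<^sub>R x) \<le> t * p x)"

lemma sublinear_add: "sublinear p \<Longrightarrow> p (x + y) \<le> p x + p y"
  by (simp add: sublinear_def)

lemma sublinear_scale_pos:
  assumes "sublinear p" "t > 0"
  shows "p (t *\<^sub>R x) = t * p x"
proof (rule antisym)
  show "p (t *\<^sub>R x) \<le> t * p x"
    using assms by (simp add: sublinear_def)
  have "p (inverse t *\<^sub>R (t *\<^sub>R x)) \<le> inverse t * p (t *\<^sub>R x)"
    using assms by (metis positive_imp_inverse_positive sublinear_def)
  then show "t * p x \<le> p (t *\<^sub>R x)"
    using assms by (simp add: field_simps)
qed

lemma sublinear_0: "sublinear p \<Longrightarrow> p 0 = 0"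
  using sublinear_scale_pos[of p 2 0] by simp

lemma sublinear_minus: "sublinear p \<Longrightarrow> - p (- x) \<le> p x"
  using sublinear_add[of p x "- x"] by (simp add: sublinear_0)

lemma sublinear_scale_nonneg:
  assumes "sublinear p" "t \<ge> 0"
  shows "p (t *\<^sub>R x) = t * p x"
  using assms sublinear_scale_pos[of p t x] by (cases "t = 0") (auto simp: sublinear_0)

text \<open>Zorn's lemma applies because the infimum of a chain stays finite: every sublinear
  functional below \<open>p\<close> is at least \<open>- p (- x)\<close> at \<open>x\<close>.\<close>

lemma minimal_sublinear_exists:
  assumes p: "sublinear p"
  obtains m where "sublinear m" "\<And>x. m x \<le> p x"
    "\<And>q. sublinear q \<Longrightarrow> (\<And>x. q x \<le> m x) \<Longrightarrow> q = m"
proof -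
  let ?S = "{q. sublinear q \<and> q \<le> p}"
  have "\<exists>m\<in>?S. \<forall>q\<in>?S. q \<le> m \<longrightarrow> q = m"
  proof (rule predicate_Zorn)
    show "partial_order_on ?S (relation_of (\<lambda>a b. b \<le> a) ?S)"
      by (rule partial_order_on_relation_ofI) auto
  next
    fix C assume "C \<in> Chains (relation_of (\<lambda>a b. b \<le> a) ?S)"
    then have C: "\<And>q. q \<in> C \<Longrightarrow> sublinear q" "\<And>q x. q \<in> C \<Longrightarrow> q x \<le> p x"
      and chain: "\<And>q r. q \<in> C \<Longrightarrow> r \<in> C \<Longrightarrow> q \<le> r \<or> r \<le> q"
      by (auto simp: Chains_def relation_of_def le_fun_def)
    show "\<exists>u\<in>?S. \<forall>q\<in>C. u \<le> q"
    proof (cases "C = {}")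
      case True
      then show ?thesis using p by auto
    next
      case False
      define u where "u x = (INF q\<in>C. q x)" for x
      have bdd: "bdd_below ((\<lambda>q. q x) ` C)" for x
      proof (rule bdd_belowI2)
        fix q assume "q \<in> C"
        then show "- p (- x) \<le> q x"
          using C(2)[of q "- x"] sublinear_minus[OF C(1), of q x] by linarith
      qed
      have le: "u x \<le> q x" if "q \<in> C" for q x
        unfolding u_def using bdd that by (rule cINF_lower)
      have ge: "c \<le> u x" if "\<And>q. q \<in> C \<Longrightarrow> c \<le> q x" for c x
        unfolding u_def using False that by (rule cINF_greatest)
      have "u (x + y) \<le> u x + u y" for x y
      proof -
        have "u (x + y) \<le> q x + r y" if q: "q \<in> C" and r: "r \<in> C" for q r
        proof -
          \<comment> \<open>the smaller of the two functionals bounds both summands\<close>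
          obtain s where s: "s \<in> C" "s \<le> q" "s \<le> r"
            using chain[OF q r] q r by blast
          have "u (x + y) \<le> s x + s y"
            using le[OF s(1), of "x + y"] sublinear_add[OF C(1)[OF s(1)], of x y] by linarith
          also have "\<dots> \<le> q x + r y"
            using s by (simp add: add_mono le_funD)
          finally show ?thesis .
        qed
        then have "u (x + y) - r y \<le> u x" if "r \<in> C" for r
          using that by (intro ge) (simp add: algebra_simps)
        then have "u (x + y) - u x \<le> u y"
          by (intro ge) (simp add: algebra_simps)
        then show ?thesis by simp
      qed
      moreover have "u (t *\<^sub>R x) \<le> t * u x" if t: "t > 0" for t x
      proof -
        have "u (t *\<^sub>R x) / t \<le> u x"
        proof (rule ge)
          fix q assume "q \<in> C"
          then show "u (t *\<^sub>R x) / t \<le> q x"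
            using le[of q "t *\<^sub>R x"] sublinear_scale_pos[OF C(1) t, of q x] t
            by (simp add: field_simps)
        qed
        then show ?thesis using t by (simp add: field_simps)
      qed
      ultimately have "sublinear u"
        by (simp add: sublinear_def)
      moreover have "u \<le> p"
        using False le C(2) by (meson ex_in_conv le_funI order_trans)
      ultimately show ?thesis
        using le by (auto simp: le_fun_def)
    qed
  qed
  then obtain m where m: "sublinear m" "m \<le> p"
      "\<And>q. sublinear q \<Longrightarrow> q \<le> p \<Longrightarrow> q \<le> m \<Longrightarrow> q = m"
    by blast
  show ?thesis
  proof (rule that[of m])
    fix q assume "sublinear q" "\<And>x. q x \<le> m x"
    then show "q = m" using m by (meson le_funI order_trans)
  qed (use m in \<open>auto simp: le_fun_def\<close>)
qed

text \<open>Lowering \<open>p\<close> as far as possible in the direction \<open>- y\<close>, keeping it sublinear, yields a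
  functional that is linear along \<open>y\<close>.  A minimal sublinear functional cannot be lowered, so for
  it the last inequality becomes \<open>p x + p y \<le> p (x + y)\<close>, which makes it additive.\<close>

lemma sublinear_lower:
  fixes p :: "'a::real_vector \<Rightarrow> real"
  assumes p: "sublinear p"
  obtains q where "sublinear q" "\<And>x. q x \<le> p x" "\<And>x. q x \<le> p (x + y) - p y"
proof -
  define q where "q x = (INF t\<in>{0..}. p (x + t *\<^sub>R y) - t * p y)" for x
  have bdd: "bdd_below ((\<lambda>t. p (x + t *\<^sub>R y) - t * p y) ` {0..})" for x
  proof (rule bdd_belowI2)
    fix t :: real assume t: "t \<in> {0..}"
    have "p (t *\<^sub>R y) \<le> p (x + t *\<^sub>R y) + p (- x)"
      using sublinear_add[OF p, of "x + t *\<^sub>R y" "- x"] by simp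
    then show "- p (- x) \<le> p (x + t *\<^sub>R y) - t * p y"
      using sublinear_scale_nonneg[OF p, of t y] t by simp
  qed
  have le: "q x \<le> p (x + t *\<^sub>R y) - t * p y" if "t \<ge> 0" for t x
    unfolding q_def using bdd that by (intro cINF_lower) auto
  have ge: "c \<le> q x" if "\<And>t. t \<ge> 0 \<Longrightarrow> c \<le> p (x + t *\<^sub>R y) - t * p y" for c x
    unfolding q_def using that by (intro cINF_greatest) auto
  have "q (x + z) \<le> q x + q z" for x z
  proof -
    have *: "q (x + z) \<le> (p (x + s *\<^sub>R y) - s * p y) + (p (z + t *\<^sub>R y) - t * p y)"
      if "s \<ge> 0" "t \<ge> 0" for s t
      using le[of "s + t" "x + z"] that
        sublinear_add[OF p, of "x + s *\<^sub>R y" "z + t *\<^sub>R y"]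
      by (simp add: algebra_simps)
    have "q (x + z) - (p (z + t *\<^sub>R y) - t * p y) \<le> q x" if "t \<ge> 0" for t
    proof (rule ge)
      fix s :: real assume "s \<ge> 0"
      then show "q (x + z) - (p (z + t *\<^sub>R y) - t * p y) \<le> p (x + s *\<^sub>R y) - s * p y"
        using *[OF _ that, of s] by linarith
    qed
    then have "q (x + z) - q x \<le> q z"
      by (intro ge) (simp add: algebra_simps)
    then show ?thesis by simp
  qed
  moreover have "q (s *\<^sub>R x) \<le> s * q x" if s: "s > 0" for s x
  proof -
    have "q (s *\<^sub>R x) / s \<le> q x"
    proof (rule ge)
      fix t :: real assume t: "t \<ge> 0"
      have "q (s *\<^sub>R x) \<le> p (s *\<^sub>R x + (s * t) *\<^sub>R y) - s * t * p y"
        using le[of "s * t" "s *\<^sub>R x"] s t by simp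
      also have "p (s *\<^sub>R x + (s * t) *\<^sub>R y) = s * p (x + t *\<^sub>R y)"
        using sublinear_scale_pos[OF p s, of "x + t *\<^sub>R y"] by (simp add: scaleR_add_right)
      finally show "q (s *\<^sub>R x) / s \<le> p (x + t *\<^sub>R y) - t * p y"
        using s by (simp add: field_simps)
    qed
    then show ?thesis using s by (simp add: field_simps)
  qed
  ultimately have "sublinear q"
    by (simp add: sublinear_def)
  moreover have "q x \<le> p x" for x
    using le[of 0 x] by simp
  moreover have "q x \<le> p (x + y) - p y" for x
    using le[of 1 x] by simp
  ultimately show ?thesis by (rule that)
qed

text \<open>The Hahn--Banach theorem.  Contact at \<open>z\<close> is arranged by lowering \<open>p\<close> along \<open>z\<close> before
  passing to a minimal functional.\<close>

theorem Hahn_Banach_sublinear: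
  fixes p :: "'a::real_vector \<Rightarrow> real"
  assumes p: "sublinear p"
  obtains f where "linear f" "\<And>x. f x \<le> p x" "f z = p z"
proof -
  obtain q where q: "sublinear q" "\<And>x. q x \<le> p x" "\<And>x. q x \<le> p (x + z) - p z"
    using sublinear_lower[OF p] by metis
  obtain m where m: "sublinear m" "\<And>x. m x \<le> q x"
      "\<And>r. sublinear r \<Longrightarrow> (\<And>x. r x \<le> m x) \<Longrightarrow> r = m"
    using minimal_sublinear_exists[OF q(1)] by metis
  have super: "m x + m y \<le> m (x + y)" for x y
  proof -
    obtain r where "sublinear r" "\<And>x. r x \<le> m x" "\<And>x. r x \<le> m (x + y) - m y"
      using sublinear_lower[OF m(1)] by metis
    then show ?thesis
      using m(3)[of r] by (metis le_diff_eq)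
  qed
  have add: "m (x + y) = m x + m y" for x y
    using super[of x y] sublinear_add[OF m(1), of x y] by linarith
  have neg: "m (- x) = - m x" for x
    using add[of x "- x"] sublinear_0[OF m(1)] by simp
  have scale: "m (t *\<^sub>R x) = t * m x" for t x
  proof (cases "t \<ge> 0")
    case True
    then show ?thesis using sublinear_scale_nonneg[OF m(1)] by blast
  next
    case False
    then show ?thesis
      using sublinear_scale_nonneg[OF m(1), of "- t" "x"] neg[of "t *\<^sub>R x"] by simp
  qed
  show ?thesis
  proof (rule that)
    show "linear m"
      using add scale by (simp add: linear_iff)
    show "m x \<le> p x" for x
      using m(2)[of x] q(2)[of x] by linarith
    then have "m z \<le> p z" .
    moreover have "- m z \<le> - p z"
      using m(2)[of "- z"] q(3)[of "- z"] neg[of z] sublinear_0[OF p] by simp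
    ultimately show "m z = p z" by simp
  qed
qed

section \<open>Functionals separating points from subspaces\<close>

lemma infdist_approx:
  assumes "U \<noteq> {}" "e > 0"
  obtains u where "u \<in> U" "dist z u < infdist z U + e"
proof -
  have "(INF a\<in>U. dist z a) < infdist z U + e"
    using assms by (simp add: infdist_notempty)
  then show ?thesis
    using cINF_less_iff[of U "dist z"] assms(1) that by (metis bdd_below_image_dist)
qed

lemma sublinear_infdist:
  fixes U :: "'a::real_normed_vector set"
  assumes U: "subspace U"
  shows "sublinear (\<lambda>x. infdist x U)"
  unfolding sublinear_def
proof (intro conjI allI impI)
  have ne: "U \<noteq> {}" using U subspace_0 by blast
  fix x y :: 'a
  show "infdist (x + y) U \<le> infdist x U + infdist y U"
  proof (rule field_le_epsilon)
    fix e :: real assume "e > 0"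
    then have e: "e / 2 > 0" by simp
    obtain a where a: "a \<in> U" "dist x a < infdist x U + e / 2"
      using infdist_approx[OF ne e] by blast
    obtain b where b: "b \<in> U" "dist y b < infdist y U + e / 2"
      using infdist_approx[OF ne e] by blast
    have "infdist (x + y) U \<le> dist (x + y) (a + b)"
      using a b U by (intro infdist_le subspace_add)
    also have "\<dots> \<le> dist x a + dist y b"
      by (rule dist_triangle_add)
    finally show "infdist (x + y) U \<le> infdist x U + infdist y U + e"
      using a b by simp
  qed
next
  have ne: "U \<noteq> {}" using U subspace_0 by blast
  fix t :: real and x :: 'a assume t: "t > 0"
  show "infdist (t *\<^sub>R x) U \<le> t * infdist x U"
  proof (rule field_le_epsilon)
    fix e :: real assume "e > 0"
    then have e: "e / t > 0" using t by simp
    obtain a where a: "a \<in> U" "dist x a < infdist x U + e / t"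
      using infdist_approx[OF ne e] by blast
    have "infdist (t *\<^sub>R x) U \<le> dist (t *\<^sub>R x) (t *\<^sub>R a)"
      using a U by (intro infdist_le subspace_scale)
    also have "\<dots> = t * dist x a"
      using t by (simp add: dist_norm flip: scaleR_diff_right)
    also have "\<dots> \<le> t * (infdist x U + e / t)"
      using a t by (intro mult_left_mono) auto
    also have "\<dots> = t * infdist x U + e"
      using t by (simp add: distrib_left)
    finally show "infdist (t *\<^sub>R x) U \<le> t * infdist x U + e" .
  qed
qed

lemma functional_of_bounded_linear:
  fixes f :: "'a::real_normed_vector \<Rightarrow> real"
  assumes "linear f" "\<And>x. f x \<le> R * norm x"
  obtains g :: "'a \<Rightarrow>\<^sub>L real" where "blinfun_apply g = f" "\<And>x. \<bar>f x\<bar> \<le> R * norm x"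
proof -
  have bound: "\<bar>f x\<bar> \<le> R * norm x" for x
    using assms(2)[of x] assms(2)[of "- x"] linear_neg[OF assms(1), of x] by simp
  then have "bounded_linear f"
    using assms(1) by (intro bounded_linear_intro[where K = R])
      (auto simp: linear_add linear_scale mult.commute)
  then show ?thesis
    using that[of "Blinfun f"] bound by (simp add: bounded_linear_Blinfun_apply)
qed

lemma subspace_separating_functional:
  fixes U :: "'a::real_normed_vector set"
  assumes U: "subspace U"
  obtains f :: "'a \<Rightarrow>\<^sub>L real" where "norm f \<le> 1" "f z = infdist z U" "\<And>u. u \<in> U \<Longrightarrow> f u = 0"
proof -
  obtain g where g: "linear g" "\<And>x. g x \<le> infdist x U" "g z = infdist z U"
    using Hahn_Banach_sublinear[OF sublinear_infdist[OF U]] by metis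
  have le: "g x \<le> 1 * norm x" for x
    using g(2)[of x] infdist_le[OF subspace_0[OF U], of x] by simp
  obtain f :: "'a \<Rightarrow>\<^sub>L real" where f: "blinfun_apply f = g" "\<And>x. \<bar>g x\<bar> \<le> 1 * norm x"
    using functional_of_bounded_linear[OF g(1) le] by metis
  show ?thesis
  proof (rule that[of f])
    show "norm f \<le> 1"
      using f by (intro norm_blinfun_bound) auto
    show "f z = infdist z U"
      using f g by simp
    fix u assume u: "u \<in> U"
    have "g u \<le> 0" "g (- u) \<le> 0"
      using g(2)[of u] g(2)[of "- u"] u U by (simp_all add: subspace_neg)
    then show "f u = 0"
      using f linear_neg[OF g(1), of u] by simp
  qed
qed

lemma norming_functional:
  fixes z :: "'a::real_normed_vector"
  obtains f :: "'a \<Rightarrow>\<^sub>L real" where "norm f \<le> 1" "f z = norm z"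
  using subspace_separating_functional[of "{0}" z] by (auto simp: subspace_0)

text \<open>A point is Birkhoff orthogonal to a subspace exactly when one of its duality functionals
  annihilates the subspace.  This gives \<open>C_dom\<close> and \<open>C_cod\<close> their metric meaning.\<close>

lemma duality_map_annihilator_iff:
  fixes U :: "'a::real_normed_vector set"
  assumes U: "subspace U"
  shows "duality_map c \<inter> annihilator U \<noteq> {} \<longleftrightarrow> (\<forall>u\<in>U. norm c \<le> norm (c - u))"
proof
  assume "duality_map c \<inter> annihilator U \<noteq> {}"
  then obtain f :: "'a \<Rightarrow>\<^sub>L real" where f: "f c = (norm c)\<^sup>2" "(norm c)\<^sup>2 = (norm f)\<^sup>2" "\<And>u. u \<in> U \<Longrightarrow> f u = 0"
    unfolding duality_map_def annihilator_def by blast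
  have nf: "norm f = norm c"
    using f(2) by simp
  show "\<forall>u\<in>U. norm c \<le> norm (c - u)"
  proof
    fix u assume u: "u \<in> U"
    have "norm c * norm c = f (c - u)"
      using f u by (simp add: blinfun.diff_right power2_eq_square)
    also have "\<dots> \<le> norm c * norm (c - u)"
      using norm_blinfun[of f "c - u"] nf by simp
    finally show "norm c \<le> norm (c - u)"
      by (cases "c = 0") auto
  qed
next
  assume orth: "\<forall>u\<in>U. norm c \<le> norm (c - u)"
  have ne: "U \<noteq> {}" using U subspace_0 by blast
  have d: "infdist c U = norm c"
  proof (rule antisym)
    show "infdist c U \<le> norm c"
      using infdist_le[OF subspace_0[OF U], of c] by simp
    show "norm c \<le> infdist c U"
      unfolding infdist_notempty[OF ne] using orth ne
      by (intro cINF_greatest) (auto simp: dist_norm)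
  qed
  obtain f :: "'a \<Rightarrow>\<^sub>L real" where f: "norm f \<le> 1" "f c = norm c" "\<And>u. u \<in> U \<Longrightarrow> f u = 0"
    using subspace_separating_functional[OF U, of c] d by metis
  \<comment> \<open>duality functionals of \<open>c\<close> have norm \<open>norm c\<close>, so the separating one is rescaled\<close>
  have "norm (norm c *\<^sub>R f) = norm c"
  proof (cases "c = 0")
    case False
    have "norm c \<le> norm f * norm c"
      using norm_blinfun[of f c] f(2) by simp
    then have "norm f = 1"
      using f(1) False by simp
    then show ?thesis by simp
  qed simp
  then have "norm c *\<^sub>R f \<in> duality_map c \<inter> annihilator U"
    using f by (auto simp: duality_map_def annihilator_def blinfun.scaleR_left power2_eq_square)
  then show "duality_map c \<inter> annihilator U \<noteq> {}" by blast
qed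

section \<open>Weak cluster points in reflexive spaces\<close>

text \<open>The upper limit of \<open>f (h i)\<close> along \<open>F\<close> is sublinear in the functional \<open>f\<close>, and it is at
  most \<open>R * norm f\<close>.  A linear functional below it lies in the bidual; by reflexivity it
  is the evaluation at a point, which serves as a weak cluster point of \<open>h\<close>.  This replaces the
  weak compactness of balls.\<close>

lemma reflexive_weak_cluster_point:
  fixes h :: "'i \<Rightarrow> 'a::real_normed_vector"
  assumes refl: "reflexive_space TYPE('a)" and F: "F \<noteq> bot"
    and bounded: "eventually (\<lambda>i. norm (h i) \<le> R) F"
  obtains x where
    "\<And>(f :: 'a \<Rightarrow>\<^sub>L real) c. eventually (\<lambda>i. f (h i) \<le> c) F \<Longrightarrow> f x \<le> c"
proof -
  define S where "S f = {c. eventually (\<lambda>i. blinfun_apply f (h i) \<le> c) F}" for f :: "'a \<Rightarrow>\<^sub>L real"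
  define p where "p f = Inf (S f)" for f
  have abs_bound: "eventually (\<lambda>i. \<bar>f (h i)\<bar> \<le> R * norm f) F" for f :: "'a \<Rightarrow>\<^sub>L real"
    using bounded
  proof eventually_elim
    case (elim i)
    have "\<bar>f (h i)\<bar> \<le> norm f * norm (h i)"
      using norm_blinfun[of f "h i"] by simp
    also have "\<dots> \<le> norm f * R"
      using elim by (intro mult_left_mono) auto
    finally show ?case by (simp add: mult.commute)
  qed
  have top: "R * norm f \<in> S f" for f
    unfolding S_def mem_Collect_eq using abs_bound[of f] by eventually_elim linarith
  have bdd: "bdd_below (S f)" for f
  proof (rule bdd_belowI)
    fix c assume "c \<in> S f"
    then have "eventually (\<lambda>i. f (h i) \<le> c \<and> \<bar>f (h i)\<bar> \<le> R * norm f) F"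
      unfolding S_def using abs_bound eventually_conj by blast
    then obtain i where "f (h i) \<le> c" "\<bar>f (h i)\<bar> \<le> R * norm f"
      using F eventually_happens by blast
    then show "- (R * norm f) \<le> c" by linarith
  qed
  have le: "p f \<le> c" if "c \<in> S f" for f c
    unfolding p_def using that bdd by (rule cInf_lower)
  have ge: "b \<le> p f" if "\<And>c. c \<in> S f \<Longrightarrow> b \<le> c" for b f
    unfolding p_def using that top by (intro cInf_greatest) auto
  have "p (f + g) \<le> p f + p g" for f g
  proof -
    have *: "p (f + g) \<le> c + d" if "c \<in> S f" "d \<in> S g" for c d
    proof (rule le)
      have "eventually (\<lambda>i. f (h i) \<le> c) F" "eventually (\<lambda>i. g (h i) \<le> d) F"
        using that by (auto simp: S_def)
      then show "c + d \<in> S (f + g)"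
        unfolding S_def mem_Collect_eq
        by eventually_elim (simp add: blinfun.add_left)
    qed
    have "p (f + g) - d \<le> p f" if "d \<in> S g" for d
      using *[OF _ that] by (intro ge) (simp add: algebra_simps)
    then have "p (f + g) - p f \<le> p g"
      by (intro ge) (simp add: algebra_simps)
    then show ?thesis by simp
  qed
  moreover have "p (t *\<^sub>R f) \<le> t * p f" if t: "t > 0" for t f
  proof -
    have "p (t *\<^sub>R f) / t \<le> p f"
    proof (rule ge)
      fix c assume "c \<in> S f"
      then have "t * c \<in> S (t *\<^sub>R f)"
        using t by (simp add: S_def blinfun.scaleR_left)
      then show "p (t *\<^sub>R f) / t \<le> c"
        using le[of "t * c" "t *\<^sub>R f"] t by (simp add: field_simps)
    qed
    then show ?thesis using t by (simp add: field_simps)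
  qed
  ultimately have "sublinear p"
    by (simp add: sublinear_def)
  then obtain \<psi> where \<psi>: "linear \<psi>" "\<And>f. \<psi> f \<le> p f"
    using Hahn_Banach_sublinear by metis
  have "\<psi> f \<le> R * norm f" for f
    using \<psi>(2)[of f] le[OF top, of f] by linarith
  then obtain \<Psi> :: "('a \<Rightarrow>\<^sub>L real) \<Rightarrow>\<^sub>L real" where \<Psi>: "blinfun_apply \<Psi> = \<psi>"
    using functional_of_bounded_linear[OF \<psi>(1)] by metis
  obtain x where x: "\<And>f. \<Psi> f = blinfun_apply f x"
    using refl unfolding reflexive_space_def by blast
  show ?thesis
  proof (rule that[of x])
    fix f :: "'a \<Rightarrow>\<^sub>L real" and c assume "eventually (\<lambda>i. f (h i) \<le> c) F"
    then have "p f \<le> c" by (intro le) (simp add: S_def)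
    then show "f x \<le> c"
      using x[of f] \<Psi> \<psi>(2)[of f] by simp
  qed
qed

text \<open>Boundedly reachable limits lie in the range, although the range need not be closed: a weak
  cluster point of the preimages is a preimage of the limit.\<close>

lemma limit_in_range_of_bounded:
  fixes A :: "'a::real_normed_vector \<Rightarrow>\<^sub>L 'b::real_normed_vector"
  assumes refl: "reflexive_space TYPE('a)" and F: "F \<noteq> bot"
    and bounded: "eventually (\<lambda>i. norm (h i) \<le> R) F"
    and lim: "((\<lambda>i. A (h i)) \<longlongrightarrow> q) F"
  shows "q \<in> range A"
proof -
  obtain x where x: "\<And>(f :: 'a \<Rightarrow>\<^sub>L real) c. eventually (\<lambda>i. f (h i) \<le> c) F \<Longrightarrow> f x \<le> c"
    using reflexive_weak_cluster_point[OF refl F bounded] by metis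
  have le: "g (A x) \<le> g q" for g :: "'b \<Rightarrow>\<^sub>L real"
  proof (rule field_le_epsilon)
    fix e :: real assume "e > 0"
    have "((\<lambda>i. g (A (h i))) \<longlongrightarrow> g q) F"
      using lim by (intro tendsto_intros)
    then have "eventually (\<lambda>i. g (A (h i)) < g q + e) F"
      using \<open>e > 0\<close> by (intro order_tendstoD) auto
    then have "eventually (\<lambda>i. (g o\<^sub>L A) (h i) \<le> g q + e) F"
      by eventually_elim simp
    then show "g (A x) \<le> g q + e"
      using x by fastforce
  qed
  obtain g :: "'b \<Rightarrow>\<^sub>L real" where "g (A x - q) = norm (A x - q)"
    using norming_functional by metis
  then have "norm (A x - q) \<le> 0"
    using le[of g] unfolding blinfun.diff_right by linarith
  then have "q = A x" by simp
  then show ?thesis by blast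
qed

section \<open>Nearest points in subspaces\<close>

lemma subspace_closure:
  fixes U :: "'a::real_normed_vector set"
  assumes U: "subspace U"
  shows "subspace (closure U)"
proof (rule subspaceI)
  show "0 \<in> closure U"
    using subspace_0[OF U] closure_subset by blast
  fix x assume "x \<in> closure U"
  then obtain a where a: "\<And>n. a n \<in> U" "a \<longlonglongrightarrow> x"
    unfolding closure_sequential by blast
  have "(\<lambda>n. t *\<^sub>R a n) \<longlonglongrightarrow> t *\<^sub>R x" for t
    using a(2) by (intro tendsto_intros)
  then show "t *\<^sub>R x \<in> closure U" for t
    unfolding closure_sequential
    using a(1) by (intro exI[of _ "\<lambda>n. t *\<^sub>R a n"]) (simp add: subspace_scale[OF U])
  fix y assume "y \<in> closure U"
  then obtain b where b: "\<And>n. b n \<in> U" "b \<longlonglongrightarrow> y"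
    unfolding closure_sequential by blast
  have "(\<lambda>n. a n + b n) \<longlonglongrightarrow> x + y"
    using a(2) b(2) by (intro tendsto_intros)
  then show "x + y \<in> closure U"
    unfolding closure_sequential
    using a(1) b(1) by (intro exI[of _ "\<lambda>n. a n + b n"]) (simp add: subspace_add[OF U])
qed

definition nearest_point :: "'a::real_normed_vector set \<Rightarrow> 'a \<Rightarrow> 'a \<Rightarrow> bool" where
  "nearest_point U z p \<longleftrightarrow> p \<in> U \<and> (\<forall>u\<in>U. norm (z - p) \<le> norm (z - u))"

text \<open>The weak cluster points of a minimizing sequence are nearest points: functionals vanishing
  on \<open>U\<close> keep them in \<open>U\<close>, and a norming functional transfers the bound on the distance.\<close>

lemma nearest_point_exists:
  fixes U :: "'a::real_normed_vector set"
  assumes refl: "reflexive_space TYPE('a)" and U: "subspace U" "closed U"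
  obtains p where "nearest_point U z p"
proof -
  have ne: "U \<noteq> {}" using U subspace_0 by blast
  define d where "d = infdist z U"
  have "\<exists>u\<in>U. dist z u < d + inverse (real (Suc n))" for n
    using infdist_approx[OF ne, of "inverse (real (Suc n))" z] unfolding d_def by auto
  then obtain h where h: "\<And>n. h n \<in> U" "\<And>n. norm (z - h n) < d + inverse (real (Suc n))"
    unfolding dist_norm by metis
  have "norm (h n) \<le> norm z + (d + 1)" for n
  proof -
    have "norm (h n) \<le> norm z + norm (z - h n)"
      using norm_triangle_sub[of "h n" z] by (simp add: norm_minus_commute)
    moreover have "inverse (real (Suc n)) \<le> 1" by (simp add: field_simps)
    ultimately show ?thesis using h(2)[of n] by linarith
  qed
  then have "eventually (\<lambda>n. norm (h n) \<le> norm z + (d + 1)) sequentially"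
    by simp
  then obtain p where
    p: "\<And>(f :: 'a \<Rightarrow>\<^sub>L real) c. eventually (\<lambda>n. f (h n) \<le> c) sequentially \<Longrightarrow> f p \<le> c"
    using reflexive_weak_cluster_point[OF refl sequentially_bot] by metis
  obtain f :: "'a \<Rightarrow>\<^sub>L real" where "f p = infdist p U" "\<And>u. u \<in> U \<Longrightarrow> f u = 0"
    using subspace_separating_functional[OF U(1), of p] by metis
  then have "infdist p U \<le> 0"
    using p[of f 0] h(1) by simp
  then have "p \<in> U"
    using in_closed_iff_infdist_zero[OF U(2) ne] infdist_nonneg[of p U] by simp
  moreover have "norm (z - p) \<le> d"
  proof (rule field_le_epsilon)
    fix e :: real assume "e > 0"
    obtain g :: "'a \<Rightarrow>\<^sub>L real" where g: "norm g \<le> 1" "g (z - p) = norm (z - p)"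
      using norming_functional by metis
    have "eventually (\<lambda>n. inverse (real (Suc n)) < e) sequentially"
      using LIMSEQ_inverse_real_of_nat \<open>e > 0\<close> by (rule order_tendstoD)
    then have "eventually (\<lambda>n. (- g) (h n) \<le> d + e - g z) sequentially"
    proof eventually_elim
      case (elim n)
      have "g (z - h n) \<le> norm g * norm (z - h n)"
        using norm_blinfun[of g "z - h n"] by simp
      also have "\<dots> \<le> 1 * norm (z - h n)"
        using g(1) by (intro mult_right_mono) auto
      finally show ?case
        using h(2)[of n] elim by (simp add: blinfun.diff_right blinfun.minus_left)
    qed
    then have "(- g) p \<le> d + e - g z" by (rule p)
    then show "norm (z - p) \<le> d + e"
      using g(2) by (simp add: blinfun.diff_right blinfun.minus_left)
  qed
  moreover have "d \<le> norm (z - u)" if "u \<in> U" for u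
    using infdist_le[OF that, of z] by (simp add: d_def dist_norm)
  ultimately have "nearest_point U z p"
    unfolding nearest_point_def by (meson order_trans)
  then show ?thesis by (rule that)
qed

text \<open>In a strictly convex space the midpoint of two nearest points would be strictly nearer.\<close>

lemma nearest_point_unique:
  fixes U :: "'a::real_normed_vector set"
  assumes sc: "strictly_convex_space TYPE('a)" and U: "subspace U"
    and p: "nearest_point U z p" and q: "nearest_point U z q"
  shows "p = q"
proof (rule ccontr)
  assume "p \<noteq> q"
  define r where "r = norm (z - p)"
  have r: "norm (z - q) = r"
    using p q unfolding nearest_point_def r_def by (meson antisym)
  have "r > 0"
    using \<open>p \<noteq> q\<close> r unfolding r_def by auto
  let ?u = "(1 / r) *\<^sub>R (z - p)" and ?v = "(1 / r) *\<^sub>R (z - q)"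
  let ?m = "(1 / 2) *\<^sub>R (p + q)"
  have "norm ?u = 1" "norm ?v = 1" "?u \<noteq> ?v"
    using \<open>r > 0\<close> \<open>p \<noteq> q\<close> r by (auto simp: r_def)
  then have "norm ((1/2) *\<^sub>R (?u + ?v)) < 1"
    using sc unfolding strictly_convex_space_def by blast
  also have "(1/2) *\<^sub>R (?u + ?v) = (1 / r) *\<^sub>R (z - ?m)"
  proof -
    have "(1/2) *\<^sub>R ((z - p) + (z - q)) = (1/2) *\<^sub>R (z + z) - ?m"
      by (simp add: scaleR_diff_right scaleR_add_right)
    then have "z - ?m = (1/2) *\<^sub>R ((z - p) + (z - q))"
      by (simp only: scaleR_half_double)
    then show ?thesis
      by (simp add: scaleR_add_right mult.commute)
  qed
  finally have "norm (z - ?m) < r"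
    using \<open>r > 0\<close> unfolding norm_scaleR by simp
  moreover have "?m \<in> U"
    using p q U by (intro subspace_scale subspace_add) (auto simp: nearest_point_def)
  ultimately show False
    using p unfolding nearest_point_def r_def by fastforce
qed

lemma metric_projection_eq:
  fixes U :: "'a::real_normed_vector set"
  assumes sc: "strictly_convex_space TYPE('a)" and U: "subspace U" and p: "nearest_point U z p"
  shows "metric_projection U z = p"
proof -
  have "u \<in> U \<and> norm (z - u) = (INF v\<in>U. norm (z - v)) \<longleftrightarrow> nearest_point U z u" for u
  proof
    assume u: "u \<in> U \<and> norm (z - u) = (INF v\<in>U. norm (z - v))"
    have "bdd_below ((\<lambda>v. norm (z - v)) ` U)" by (rule bdd_belowI2[of _ 0]) simp
    then show "nearest_point U z u"
      using u unfolding nearest_point_def by (auto intro: cINF_lower)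
  next
    assume "nearest_point U z u"
    then show "u \<in> U \<and> norm (z - u) = (INF v\<in>U. norm (z - v))"
      unfolding nearest_point_def by (auto intro!: cInf_eq_minimum[symmetric])
  qed
  then show ?thesis
    unfolding metric_projection_def
    using p nearest_point_unique[OF sc U] by (auto intro!: the_equality)
qed

section \<open>The metric generalized inverse\<close>

lemma subspace_null_space: "subspace (null_space A)"
  unfolding null_space_def by (auto simp: subspace_def blinfun.add_right blinfun.scaleR_right)

lemma closed_null_space: "closed (null_space A)"
proof -
  have "closed {x. A x = 0}"
    by (intro closed_Collect_eq continuous_intros)
  then show ?thesis by (simp add: null_space_def)
qed

lemma subspace_range: "subspace (range (blinfun_apply A))"
proof -
  have "linear A"
    by (simp add: linear_iff blinfun.add_right blinfun.scaleR_right)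
  then show ?thesis by (simp add: linear_subspace_image)
qed

lemma C_dom_iff: "z \<in> C_dom A \<longleftrightarrow> (\<forall>v. A v = A z \<longrightarrow> norm z \<le> norm v)"
proof -
  have "(\<forall>u\<in>null_space A. norm z \<le> norm (z - u)) \<longleftrightarrow> (\<forall>v. A v = A z \<longrightarrow> norm z \<le> norm v)"
  proof (intro iffI allI impI ballI)
    fix v assume *: "\<forall>u\<in>null_space A. norm z \<le> norm (z - u)" and "A v = A z"
    then have "z - v \<in> null_space A" by (simp add: null_space_def blinfun.diff_right)
    with * show "norm z \<le> norm v" by fastforce
  qed (simp add: null_space_def blinfun.diff_right)
  then show ?thesis
    by (simp add: C_dom_def duality_map_annihilator_iff subspace_null_space)
qed

lemma inj_on_C_dom:
  fixes A :: "'a::real_normed_vector \<Rightarrow>\<^sub>L 'b::real_normed_vector"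
  assumes sc: "strictly_convex_space TYPE('a)"
  shows "inj_on A (C_dom A)"
proof (rule inj_onI)
  fix v w assume v: "v \<in> C_dom A" and w: "w \<in> C_dom A" and eq: "A v = A w"
  have min: "norm v \<le> norm (v - u)" "norm w \<le> norm (v - u)" if "u \<in> null_space A" for u
    using v w eq that unfolding C_dom_iff by (simp_all add: null_space_def blinfun.diff_right)
  \<comment> \<open>both \<open>0\<close> and \<open>v - w\<close> are nearest to \<open>v\<close> among the null vectors\<close>
  have "nearest_point (null_space A) v 0" "nearest_point (null_space A) v (v - w)"
    using min eq by (auto simp: nearest_point_def null_space_def blinfun.diff_right)
  then have "0 = v - w"
    using nearest_point_unique[OF sc subspace_null_space] by blast
  then show "v = w" by simp
qed

text \<open>Subtracting from any preimage its nearest null vector leaves a preimage of least norm.\<close>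

lemma C_dom_onto_range:
  fixes A :: "'a::real_normed_vector \<Rightarrow>\<^sub>L 'b::real_normed_vector"
  assumes refl: "reflexive_space TYPE('a)" and q: "q \<in> range A"
  obtains z where "z \<in> C_dom A" "A z = q"
proof -
  obtain x where x: "A x = q" using q by blast
  obtain n where n: "nearest_point (null_space A) x n"
    using nearest_point_exists[OF refl subspace_null_space closed_null_space] by metis
  have A: "A (x - n) = q"
    using n x by (simp add: nearest_point_def null_space_def blinfun.diff_right)
  have "norm (x - n) \<le> norm v" if "A v = q" for v
  proof -
    have "x - v \<in> null_space A" using x that by (simp add: null_space_def blinfun.diff_right)
    then show ?thesis using n unfolding nearest_point_def by fastforce
  qed
  then have "x - n \<in> C_dom A" using A by (simp add: C_dom_iff)
  then show ?thesis using A by (rule that)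
qed

text \<open>In a decomposition \<open>y = r + c\<close> with \<open>c \<in> C_cod A\<close>, the residual \<open>c\<close> is orthogonal to the
  range, hence by continuity of the norm to its closure, so \<open>r\<close> is nearest to \<open>y\<close> even among
  the points of the closure.\<close>

lemma mgi_domain_iff:
  fixes A :: "'a::real_normed_vector \<Rightarrow>\<^sub>L 'b::real_normed_vector"
  shows "y \<in> mgi_domain A \<longleftrightarrow> (\<exists>r. r \<in> range A \<and> nearest_point (closure (range A)) y r)"
proof -
  have orth: "c \<in> C_cod A \<longleftrightarrow> (\<forall>u\<in>closure (range A). norm c \<le> norm (c - u))" for c
  proof -
    have "closed {u. norm c \<le> norm (c - u)}"
      by (intro closed_Collect_le continuous_intros)
    then have "range A \<subseteq> {u. norm c \<le> norm (c - u)} \<Longrightarrow>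
        closure (range A) \<subseteq> {u. norm c \<le> norm (c - u)}"
      by (rule closure_minimal[rotated])
    then show ?thesis
      using closure_subset[of "range A"]
      by (auto simp: C_cod_def duality_map_annihilator_iff subspace_range)
  qed
  have near: "nearest_point (closure (range A)) y r \<longleftrightarrow> y - r \<in> C_cod A" if r: "r \<in> range A" for r
  proof -
    let ?U = "closure (range A)"
    have rU: "r \<in> ?U" and U: "subspace ?U"
      using r closure_subset[of "range A"] subspace_range[of A] by (blast intro: subspace_closure)+
    have "(\<forall>u\<in>?U. norm (y - r) \<le> norm (y - u)) \<longleftrightarrow> (\<forall>u\<in>?U. norm (y - r) \<le> norm (y - r - u))"
    proof (intro iffI ballI)
      fix u assume "\<forall>u\<in>?U. norm (y - r) \<le> norm (y - u)" "u \<in> ?U"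
      then show "norm (y - r) \<le> norm (y - r - u)"
        using subspace_add[OF U rU, of u] by (metis diff_diff_add)
    next
      fix u assume *: "\<forall>u\<in>?U. norm (y - r) \<le> norm (y - r - u)" "u \<in> ?U"
      then have "u - r \<in> ?U" using subspace_diff[OF U _ rU] by blast
      then show "norm (y - r) \<le> norm (y - u)"
        using *(1) by fastforce
    qed
    then show ?thesis using rU by (simp add: nearest_point_def orth)
  qed
  show ?thesis
  proof
    assume "y \<in> mgi_domain A"
    then show "\<exists>r. r \<in> range A \<and> nearest_point (closure (range A)) y r"
      using near by (fastforce simp: mgi_domain_def)
  next
    assume "\<exists>r. r \<in> range A \<and> nearest_point (closure (range A)) y r"
    then obtain r where "r \<in> range A" "y - r \<in> C_cod A" using near by blast
    moreover have "y = r + (y - r)" by simp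
    ultimately show "y \<in> mgi_domain A" unfolding mgi_domain_def by blast
  qed
qed

lemma minimum_norm_solution_iff:
  fixes A :: "'a::real_normed_vector \<Rightarrow>\<^sub>L 'b::real_normed_vector"
  assumes sc: "strictly_convex_space TYPE('b)"
    and r: "r \<in> range A" "nearest_point (closure (range A)) y r"
  shows "minimum_norm_solution A y z \<longleftrightarrow> A z = r \<and> z \<in> C_dom A"
proof -
  have near: "nearest_point (closure (range A)) y (A v)" if "norm (y - A v) = norm (y - r)" for v
    using r that closure_subset[of "range A"] by (auto simp: nearest_point_def)
  have U: "subspace (closure (range A))"
    by (intro subspace_closure subspace_range)
  have min: "is_arg_min (\<lambda>x. norm (A x - y)) (\<lambda>_. True) v \<longleftrightarrow> A v = r" for v
  proof
    assume v: "is_arg_min (\<lambda>x. norm (A x - y)) (\<lambda>_. True) v"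
    obtain x where x: "r = A x" using r by blast
    have "norm (y - A v) \<le> norm (y - r)"
      using v x by (auto simp: is_arg_min_linorder norm_minus_commute)
    moreover have "norm (y - r) \<le> norm (y - A v)"
      using r closure_subset[of "range A"] by (auto simp: nearest_point_def)
    ultimately show "A v = r"
      using near[of v] nearest_point_unique[OF sc U _ r(2)] by simp
  next
    assume v: "A v = r"
    have "norm (y - r) \<le> norm (y - A x)" for x
      using r(2) closure_subset[of "range A"] by (auto simp: nearest_point_def)
    then show "is_arg_min (\<lambda>x. norm (A x - y)) (\<lambda>_. True) v"
      by (simp add: is_arg_min_linorder v norm_minus_commute[of _ y])
  qed
  show ?thesis
    unfolding minimum_norm_solution_def is_arg_min_linorder[of norm] min C_dom_iff by auto
qed

theorem theorem3:
  fixes A :: "'a::banach \<Rightarrow>\<^sub>L 'b::banach"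
    and x :: "real \<Rightarrow> 'b \<Rightarrow> 'a"
    and y :: 'b
  assumes "reflexive_space TYPE('a)" and "strictly_convex_space TYPE('a)"
    and "reflexive_space TYPE('b)" and "strictly_convex_space TYPE('b)"
    and "parametric_regularization A x"
  shows "(y \<in> mgi_domain A \<and>
           (\<exists>!z. minimum_norm_solution A y z) \<and> minimum_norm_solution A y (mgi A y) \<and>
           ((\<lambda>\<alpha>. x \<alpha> y) \<longlongrightarrow> mgi A y) (at_right 0)) \<or>
         (y \<notin> mgi_domain A \<and>
           filterlim (\<lambda>\<alpha>. norm (x \<alpha> y)) at_top (at_right 0))"
proof -
  let ?U = "closure (range A)"
  have U: "subspace ?U"
    by (intro subspace_closure subspace_range)
  obtain r where r: "nearest_point ?U y r"
    using nearest_point_exists[OF assms(3) U closed_closure] by metis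
  have proj: "metric_projection ?U y = r"
    by (rule metric_projection_eq[OF assms(4) U r])
  have dom: "y \<in> mgi_domain A \<longleftrightarrow> r \<in> range A"
    unfolding mgi_domain_iff using r nearest_point_unique[OF assms(4) U] by blast
  show ?thesis
  proof (cases "y \<in> mgi_domain A")
    case True
    then have rA: "r \<in> range A" using dom by simp
    obtain z where z: "z \<in> C_dom A" "A z = r"
      using C_dom_onto_range[OF assms(1) rA] by metis
    note inj = inj_on_C_dom[OF assms(2), of A]
    have mgi: "mgi A y = z"
      unfolding mgi_def proj using the_inv_into_f_f[OF inj z(1)] z(2) by simp
    have "minimum_norm_solution A y w \<longleftrightarrow> w = z" for w
      unfolding minimum_norm_solution_iff[OF assms(4) rA r]
      using z inj by (auto dest: inj_onD)
    moreover have "((\<lambda>\<alpha>. x \<alpha> y) \<longlongrightarrow> mgi A y) (at_right 0)"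
      using assms(5) True by (simp add: parametric_regularization_def)
    ultimately show ?thesis using True mgi by auto
  next
    case False
    have "filterlim (\<lambda>\<alpha>. norm (x \<alpha> y)) at_top (at_right 0)"
    proof (rule ccontr)
      assume "\<not> ?thesis"
      then obtain R where R: "\<not> eventually (\<lambda>\<alpha>. R \<le> norm (x \<alpha> y)) (at_right 0)"
        unfolding filterlim_at_top by blast
      \<comment> \<open>restrict to the parameters whose approximations stay below \<open>R\<close>\<close>
      define F where "F = inf (at_right 0) (principal {\<alpha>. norm (x \<alpha> y) \<le> R})"
      have "F \<noteq> bot"
      proof
        assume "F = bot"
        then have "eventually (\<lambda>\<alpha>. \<not> norm (x \<alpha> y) \<le> R) (at_right 0)"
          by (simp add: F_def trivial_limit_def eventually_inf_principal)
        then have "eventually (\<lambda>\<alpha>. R \<le> norm (x \<alpha> y)) (at_right 0)"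
          by eventually_elim simp
        with R show False by contradiction
      qed
      moreover have "eventually (\<lambda>\<alpha>. norm (x \<alpha> y) \<le> R) F"
        by (simp add: F_def eventually_inf_principal)
      moreover have "((\<lambda>\<alpha>. A (x \<alpha> y)) \<longlongrightarrow> r) F"
      proof (rule tendsto_mono)
        show "F \<le> at_right 0" by (simp add: F_def)
        show "((\<lambda>\<alpha>. A (x \<alpha> y)) \<longlongrightarrow> r) (at_right 0)"
          using assms(5) proj by (auto simp: parametric_regularization_def)
      qed
      ultimately have "r \<in> range A"
        by (rule limit_in_range_of_bounded[OF assms(1)])
      with False dom show False by simp
    qed
    with False show ?thesis by blast
  qed
qed

end
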